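(* There exists a probability measure $\pi$ on $\mathbb{R}^2$, with first marginal $\mu$ and second marginal $\nu$, such that $\nu(D)=0$ (in particular condition $(\mathcal{D})$ does not hold), $\mu$ and $\nu$ are absolutely continuous with respect to the Lebesgue measure, and property $(\mathcal{R}_+)$ holds.
   Context: For a probability measure $\pi$ on $\mathbb{R}\times\mathcal{Y}$, here with $\mathcal{Y}=\mathbb{R}$, with first marginal $\mu$ and second marginal $\nu$, fix probability kernels $(\pi_{X=x})_{x\in\mathbb{R}}$ (probability measures on $\mathcal{Y}$) and $(\pi_{Y=y})_{y\in\mathcal{Y}}$ (probability measures on $\mathbb{R}$) disintegrating $\pi$: $\pi(dx,dy)=\mu(dx)\,\pi_{X=x}(dy)=\nu(dy)\,\pi_{Y=y}(dx)$. $D$ is the Borel set $D=\{y\in\mathcal{Y}:\pi_{Y=y}\text{ is a Dirac mass}\}$. $L^1_+(\mu)$ denotes the set of non-negative elements of $L^1(\mu)$. Condition $(\mathcal{D})$: $\pi_{X=x}(D)>0$ for $\mu$-a.e. $x$. Property $(\mathcal{R}_+)$: for every $f\in L^1_+(\mu)$ there exists a measurable $g:\mathcal{Y}\to\mathbb{R}_+=[0,\infty)$ such that $f(x)=\int_{\mathcal{Y}}g(y)\,\pi_{X=x}(dy)$ for $\mu$-a.e. $x$. *)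

theory Defs
  imports "HOL-Probability.Probability"
begin

definition marginal_X :: "(real \<times> real) measure \<Rightarrow> real measure" where
  "marginal_X \<pi> = distr \<pi> borel fst"

definition marginal_Y :: "(real \<times> real) measure \<Rightarrow> real measure" where
  "marginal_Y \<pi> = distr \<pi> borel snd"

definition prob_kernel :: "(real \<Rightarrow> real measure) \<Rightarrow> bool" where
  "prob_kernel K \<longleftrightarrow> K \<in> borel \<rightarrow>\<^sub>M prob_algebra borel"

text \<open>The identities \<open>\<pi>(dx,dy) = \<mu>(dx) \<pi>\<^bsub>X=x\<^esub>(dy)\<close> and \<open>\<pi>(dx,dy) = \<nu>(dy) \<pi>\<^bsub>Y=y\<^esub>(dx)\<close>,
  evaluated on Borel sets of the plane; the kernel is charged with the section of the set.\<close>

definition disintegrates_X :: "(real \<times> real) measure \<Rightarrow> (real \<Rightarrow> real measure) \<Rightarrow> bool" where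
  "disintegrates_X \<pi> K \<longleftrightarrow> prob_kernel K \<and>
     (\<forall>E\<in>sets borel. emeasure \<pi> E = (\<integral>\<^sup>+x. emeasure (K x) {y. (x, y) \<in> E} \<partial>marginal_X \<pi>))"

definition disintegrates_Y :: "(real \<times> real) measure \<Rightarrow> (real \<Rightarrow> real measure) \<Rightarrow> bool" where
  "disintegrates_Y \<pi> K \<longleftrightarrow> prob_kernel K \<and>
     (\<forall>E\<in>sets borel. emeasure \<pi> E = (\<integral>\<^sup>+y. emeasure (K y) {x. (x, y) \<in> E} \<partial>marginal_Y \<pi>))"

definition dirac_set :: "(real \<Rightarrow> real measure) \<Rightarrow> real set" where
  "dirac_set K = {y. \<exists>x. K y = return borel x}"

definition condition_D ::
    "(real \<times> real) measure \<Rightarrow> (real \<Rightarrow> real measure) \<Rightarrow> (real \<Rightarrow> real measure) \<Rightarrow> bool" where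
  "condition_D \<pi> KX KY \<longleftrightarrow> (AE x in marginal_X \<pi>. emeasure (KX x) (dirac_set KY) > 0)"

text \<open>The integral of \<open>g\<close> is taken in \<open>[0, \<infinity>]\<close>, since the Bochner integral of a
  non-integrable \<open>g\<close> would be \<open>0\<close>. Elements of \<open>L\<^sup>1\<close> are classes modulo \<open>\<mu>\<close>-null sets, hence
  non-negativity of \<open>f\<close> is only required almost everywhere.\<close>

definition property_R_plus :: "(real \<times> real) measure \<Rightarrow> (real \<Rightarrow> real measure) \<Rightarrow> bool" where
  "property_R_plus \<pi> KX \<longleftrightarrow>
     (\<forall>f :: real \<Rightarrow> real. integrable (marginal_X \<pi>) f \<and> (AE x in marginal_X \<pi>. 0 \<le> f x) \<longrightarrow>
        (\<exists>g :: real \<Rightarrow> real. g \<in> borel_measurable borel \<and> (\<forall>y. 0 \<le> g y) \<and>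
           (AE x in marginal_X \<pi>. ennreal (f x) = (\<integral>\<^sup>+y. ennreal (g y) \<partial>KX x))))"

end

theory Submission imports Defs begin

text \<open>
  Let \<open>flip n\<close> swap, within consecutive pairs of cells of width \<open>1 / (2 n + 2)\<close>, the two cells by
  translation. Take \<open>X\<close> uniform on \<open>[0, 1)\<close>, \<open>N\<close> independent and geometric, and let \<open>Y\<close> encode \<open>N\<close>
  together with the orbit \<open>{X, flip N X}\<close>. Given \<open>Y\<close>, the variable \<open>X\<close> is uniform on a two-point
  orbit, so no conditional law is a Dirac mass.

  For \<open>f \<ge> 0\<close>, property \<open>(R\<^sub>+)\<close> asks for \<open>f = (\<Sum>n. h n)\<close> with \<open>h n \<ge> 0\<close> invariant under \<open>flip n\<close>. The
  greedy choice subtracts from the current residual \<open>r\<close> its largest invariant minorant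
  \<open>min r (r \<circ> flip n)\<close>. After step \<open>n\<close> the residual vanishes at \<open>x\<close> or at \<open>flip n x\<close>, so the set \<open>A\<close> on
  which all residuals are positive is disjoint from all its images under the flips. As \<open>flip n\<close> preserves
  Lebesgue measure and tends uniformly to the identity, \<open>A\<close> is null: almost everywhere the greedy
  procedure stops after finitely many steps.
\<close>

subsection \<open>Flips of the unit interval\<close>

text \<open>The factor 2 n + 2 is positive and even for every n, so the unit interval is a union of
  whole pairs of cells.\<close>

definition flip :: "nat \<Rightarrow> real \<Rightarrow> real" where
  "flip n x = (if even \<lfloor>(2 * real n + 2) * x\<rfloor> then x + 1 / (2 * real n + 2) else x - 1 / (2 * real n + 2))"

text \<open>The orbit point in an even-numbered cell serves as a measurable label of the whole
  orbit.\<close>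

definition flip_rep :: "nat \<Rightarrow> real \<Rightarrow> real" where
  "flip_rep n x = (if even \<lfloor>(2 * real n + 2) * x\<rfloor> then x else flip n x)"

definition unif01 :: "real measure" where
  "unif01 = density lborel (indicator {0..<1})"

text \<open>Scaling by 2 n + 2 gives the cells width 1, so a flip moves the integer cell index by
  one, in a direction set by its parity.\<close>

lemma floor_flip:
  "\<lfloor>(2 * real n + 2) * flip n x\<rfloor> =
     (if even \<lfloor>(2 * real n + 2) * x\<rfloor> then \<lfloor>(2 * real n + 2) * x\<rfloor> + 1 else \<lfloor>(2 * real n + 2) * x\<rfloor> - 1)"
proof -
  have "(2 * real n + 2) * (x + 1 / (2 * real n + 2)) = (2 * real n + 2) * x + 1"
       "(2 * real n + 2) * (x - 1 / (2 * real n + 2)) = (2 * real n + 2) * x - 1"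
    by (simp_all add: distrib_left right_diff_distrib)
  then show ?thesis
    by (simp add: flip_def)
qed

lemma even_floor_flip:
  "even \<lfloor>(2 * real n + 2) * flip n x\<rfloor> \<longleftrightarrow> odd \<lfloor>(2 * real n + 2) * x\<rfloor>"
  by (simp add: floor_flip)

lemma flip_flip [simp]: "flip n (flip n x) = x"
  using even_floor_flip[of n x] by (simp add: flip_def split: if_splits)

lemma flip_rep_flip [simp]: "flip_rep n (flip n x) = flip_rep n x"
  by (simp add: flip_rep_def even_floor_flip)

lemma flip_rep_cases: "flip_rep n x = x \<or> flip_rep n x = flip n x"
  by (simp add: flip_rep_def)

lemma abs_flip_diff: "\<bar>flip n x - x\<bar> = 1 / (2 * real n + 2)"
  by (simp add: flip_def)

lemma flip_neq: "flip n x \<noteq> x"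
  using abs_flip_diff[of n x] by auto

text \<open>The unit interval consists of the cells 0 to 2 n + 1, and exchanging 2 j with 2 j + 1
  maps this index range onto itself.\<close>

lemma flip_unit_iff [simp]: "flip n x \<in> {0..<1} \<longleftrightarrow> x \<in> {0..<1}"
proof -
  define N where "N = 2 * real n + 2"
  have N: "N > 0" by (simp add: N_def)
  have unit: "y \<in> {0..<1} \<longleftrightarrow> 0 \<le> \<lfloor>N * y\<rfloor> \<and> \<lfloor>N * y\<rfloor> < 2 * int n + 2" for y
  proof -
    have "0 \<le> \<lfloor>N * y\<rfloor> \<longleftrightarrow> 0 \<le> y"
      using N by (simp add: zero_le_mult_iff)
    moreover have "\<lfloor>N * y\<rfloor> < 2 * int n + 2 \<longleftrightarrow> N * y < N"
      by (subst floor_less_iff) (simp add: N_def)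
    ultimately show ?thesis
      using N by simp
  qed
  define k where "k = \<lfloor>N * x\<rfloor>"
  have "\<lfloor>N * flip n x\<rfloor> = (if even k then k + 1 else k - 1)"
    using floor_flip[of n x] by (simp add: N_def k_def)
  then show ?thesis
    unfolding unit k_def[symmetric] by (cases "even k"; simp only: if_True if_False; presburger)
qed

lemma flip_rep_unit: "x \<in> {0..<1} \<Longrightarrow> flip_rep n x \<in> {0..<1}"
  using flip_rep_cases[of n x] by (metis flip_unit_iff)

text \<open>The label lies in [0, 1), so integer and fractional part let one real number carry both
  the index and the orbit.\<close>

lemma decode_flip_rep:
  assumes "x \<in> {0..<1}"
  shows "nat \<lfloor>real n + flip_rep n x\<rfloor> = n" "frac (real n + flip_rep n x) = flip_rep n x"
proof -
  have "\<lfloor>flip_rep n x\<rfloor> = 0"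
    using flip_rep_unit[OF assms, of n] by (simp add: floor_eq_iff)
  then show "nat \<lfloor>real n + flip_rep n x\<rfloor> = n" "frac (real n + flip_rep n x) = flip_rep n x"
    by (simp_all add: frac_def)
qed

lemma measurable_flip [measurable (raw)]:
  assumes [measurable]: "f \<in> M \<rightarrow>\<^sub>M count_space UNIV" "g \<in> borel_measurable M"
  shows "(\<lambda>x. flip (f x) (g x)) \<in> borel_measurable M"
  unfolding flip_def by measurable

lemma measurable_flip_rep [measurable (raw)]:
  assumes [measurable]: "f \<in> M \<rightarrow>\<^sub>M count_space UNIV" "g \<in> borel_measurable M"
  shows "(\<lambda>x. flip_rep (f x) (g x)) \<in> borel_measurable M"
  unfolding flip_rep_def by measurable

section \<open>Lebesgue measure on the unit interval and its invariance under flips\<close>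

lemma sets_unif01 [simp, measurable_cong]: "sets unif01 = sets borel"
  by (simp add: unif01_def)

lemma space_unif01 [simp]: "space unif01 = UNIV"
  by (simp add: unif01_def)

lemma prob_space_unif01: "prob_space unif01"
  by standard (simp add: unif01_def emeasure_density)

text \<open>The flip is translation by \<open>c\<close> on the even cells and by \<open>-c\<close>
  on the odd ones, and translation by \<open>c\<close> exchanges the two families. Substituting in
  each half of the integral therefore swaps the halves.\<close>

lemma nn_integral_lborel_flip:
  assumes [measurable]: "f \<in> borel_measurable borel"
  shows "(\<integral>\<^sup>+x. f (flip n x) \<partial>lborel) = (\<integral>\<^sup>+x. f x \<partial>lborel)"
proof -
  define c where "c = 1 / (2 * real n + 2)"
  define F where "F = {x. even \<lfloor>(2 * real n + 2) * x\<rfloor>}"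
  have [measurable]: "F \<in> sets borel"
    unfolding F_def by measurable
  have c: "\<lfloor>(2 * real n + 2) * (c + x)\<rfloor> = \<lfloor>(2 * real n + 2) * x\<rfloor> + 1" for x
  proof -
    have "(2 * real n + 2) * (c + x) = (2 * real n + 2) * x + 1"
      by (simp add: c_def distrib_left)
    then show ?thesis by simp
  qed
  have F: "c + x \<in> F \<longleftrightarrow> x \<notin> F" for x
    by (simp add: F_def c)
  have "(\<integral>\<^sup>+x. f (flip n x) \<partial>lborel) =
        (\<integral>\<^sup>+x. indicator F x * f (c + x) + indicator (-F) x * f (x - c) \<partial>lborel)"
    by (intro nn_integral_cong) (simp add: flip_def F_def c_def add.commute indicator_def)
  also have "\<dots> = (\<integral>\<^sup>+x. indicator F x * f (c + x) \<partial>lborel) + (\<integral>\<^sup>+x. indicator (-F) x * f (x - c) \<partial>lborel)"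
    by (intro nn_integral_add) auto
  also have "(\<integral>\<^sup>+x. indicator (-F) x * f (x - c) \<partial>lborel) = (\<integral>\<^sup>+x. indicator F x * f x \<partial>lborel)"
    by (subst nn_integral_real_affine[where c=1 and t=c]) (auto simp: F indicator_def)
  also have "(\<integral>\<^sup>+x. indicator F x * f (c + x) \<partial>lborel) = (\<integral>\<^sup>+x. indicator (-F) x * f x \<partial>lborel)"
    by (subst (2) nn_integral_real_affine[where c=1 and t=c]) (auto simp: F indicator_def)
  also have "(\<integral>\<^sup>+x. indicator (-F) x * f x \<partial>lborel) + (\<integral>\<^sup>+x. indicator F x * f x \<partial>lborel) =
      (\<integral>\<^sup>+x. indicator (-F) x * f x + indicator F x * f x \<partial>lborel)"
    by (intro nn_integral_add[symmetric]) auto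
  also have "\<dots> = (\<integral>\<^sup>+x. f x \<partial>lborel)"
    by (intro nn_integral_cong) (auto simp: indicator_def)
  finally show ?thesis .
qed

lemma nn_integral_unif01_flip:
  assumes [measurable]: "f \<in> borel_measurable borel"
  shows "(\<integral>\<^sup>+x. f (flip n x) \<partial>unif01) = (\<integral>\<^sup>+x. f x \<partial>unif01)"
proof -
  have "(\<integral>\<^sup>+x. f (flip n x) \<partial>unif01) = (\<integral>\<^sup>+x. indicator {0..<1} (flip n x) * f (flip n x) \<partial>lborel)"
    by (simp add: unif01_def nn_integral_density indicator_def del: atLeastLessThan_iff)
  also have "\<dots> = (\<integral>\<^sup>+x. indicator {0..<1} x * f x \<partial>lborel)"
    by (subst nn_integral_lborel_flip[symmetric]) auto
  also have "\<dots> = (\<integral>\<^sup>+x. f x \<partial>unif01)"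
    by (simp add: unif01_def nn_integral_density)
  finally show ?thesis .
qed

lemma emeasure_unif01_flip:
  assumes [measurable]: "A \<in> sets borel"
  shows "emeasure unif01 (flip n -` A) = emeasure unif01 A"
proof -
  have "flip n -` A \<in> sets borel"
    using measurable_sets[of "flip n" borel borel A] by simp
  then show ?thesis
    using nn_integral_unif01_flip[of "indicator A" n]
    by (simp add: indicator_vimage[symmetric] indicator_inter_arith flip: nn_integral_indicator)
qed

lemma AE_unif01_unit: "AE x in unif01. x \<in> {0..<1}"
  unfolding unif01_def by (subst AE_density) (auto simp: indicator_def)

text \<open>Since \<open>flip n\<close> is uniformly close to the identity, it moves a compact subset \<open>K\<close> of \<open>A\<close>
  into a neighbourhood of \<open>K\<close> of measure less than \<open>2 |K|\<close>, which cannot contain two disjoint copies of \<open>K\<close>.\<close>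

lemma unif01_null_if_flip_disjoint:
  assumes A [measurable]: "A \<in> sets borel"
    and disj: "\<And>n. A \<inter> flip n -` A = {}"
  shows "emeasure unif01 A = 0"
proof (rule ccontr)
  interpret prob_space unif01 by (rule prob_space_unif01)
  assume "emeasure unif01 A \<noteq> 0"
  then have "0 < (SUP K\<in>{K. K \<subseteq> A \<and> compact K}. emeasure unif01 K)"
    by (subst inner_regular[symmetric]) (auto simp: zero_less_iff_neq_zero)
  then obtain K where K: "K \<subseteq> A" "compact K" and K0: "0 < emeasure unif01 K"
    by (auto simp: less_SUP_iff)
  have K_sets [measurable]: "K \<in> sets borel"
    using K by (simp add: compact_imp_closed)
  have fin: "emeasure unif01 K < \<infinity>"
    by (simp add: emeasure_eq_measure)
  \<comment> \<open>Because 0 < |K| < infinity, 2 |K| is strictly larger than |K|, which leaves room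
    for an open neighbourhood of \<open>K\<close>.\<close>
  have "(INF U\<in>{U. K \<subseteq> U \<and> open U}. emeasure unif01 U) < emeasure unif01 K + emeasure unif01 K"
    using K0 fin by (subst outer_regular[symmetric]) (auto simp: emeasure_eq_measure ennreal_less_iff simp flip: ennreal_plus)
  then obtain U where U: "K \<subseteq> U" "open U" and less: "emeasure unif01 U < emeasure unif01 K + emeasure unif01 K"
    by (auto simp: INF_less_iff)
  \<comment> \<open>Compactness gives one radius for all points of \<open>K\<close>, so a single
    flip with small enough displacement serves them all.\<close>
  obtain \<epsilon> where e: "\<epsilon> > 0" "(\<Union>x\<in>K. ball x \<epsilon>) \<subseteq> U"
    using compact_subset_open_imp_ball_epsilon_subset[OF K(2) U(2) U(1)] by metis
  obtain n where n: "1 / real (Suc n) < \<epsilon>"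
    using e(1) nat_approx_posE by blast
  have "1 / (2 * real n + 2) < \<epsilon>"
    by (rule le_less_trans[OF _ n]) (simp add: field_simps)
  then have "x \<in> ball (flip n x) \<epsilon>" for x
    using abs_flip_diff[of n x] by (simp add: dist_real_def)
  then have sub: "flip n -` K \<subseteq> U"
    using e(2) by blast
  have [measurable]: "flip n -` K \<in> sets borel"
    using measurable_sets[of "flip n" borel borel K] by simp
  have "emeasure unif01 K + emeasure unif01 K = emeasure unif01 (K \<union> flip n -` K)"
    using K(1) disj[of n] by (subst plus_emeasure[symmetric]) (auto simp: emeasure_unif01_flip)
  also have "\<dots> \<le> emeasure unif01 U"
    using U sub by (intro emeasure_mono) auto
  finally show False
    using less by simp
qed

subsection \<open>Greedy decomposition into flip-invariant functions\<close>

text \<open>\<open>residual f n\<close> is what remains just before step n, that is, after the steps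
  of smaller index.\<close>

primrec residual :: "(real \<Rightarrow> real) \<Rightarrow> nat \<Rightarrow> real \<Rightarrow> real" where
  "residual f 0 x = f x"
| "residual f (Suc n) x = residual f n x - min (residual f n x) (residual f n (flip n x))"

definition greedy :: "(real \<Rightarrow> real) \<Rightarrow> nat \<Rightarrow> real \<Rightarrow> real" where
  "greedy f n x = min (residual f n x) (residual f n (flip n x))"

lemma measurable_residual [measurable]:
  assumes "f \<in> borel_measurable borel"
  shows "residual f n \<in> borel_measurable borel"
proof (induction n)
  case 0
  then show ?case using assms by (simp cong: measurable_cong)
next
  case (Suc n)
  note [measurable] = Suc
  show ?case
    unfolding residual.simps[abs_def] by measurable
qed

lemma measurable_greedy [measurable]:
  assumes [measurable]: "f \<in> borel_measurable borel"
  shows "greedy f n \<in> borel_measurable borel"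
  unfolding greedy_def by measurable

lemma residual_nonneg: "(\<And>x. 0 \<le> f x) \<Longrightarrow> 0 \<le> residual f n x"
  by (induction n arbitrary: x) auto

lemma greedy_nonneg: "(\<And>x. 0 \<le> f x) \<Longrightarrow> 0 \<le> greedy f n x"
  by (simp add: greedy_def residual_nonneg)

lemma greedy_flip: "greedy f n (flip n x) = greedy f n x"
  by (simp add: greedy_def min.commute)

lemma greedy_flip_rep: "greedy f n (flip_rep n x) = greedy f n x"
  using flip_rep_cases[of n x] by (metis greedy_flip)

lemma sum_greedy: "(\<Sum>k<n. greedy f k x) = f x - residual f n x"
  by (induction n) (auto simp: greedy_def)

text \<open>The residual at the partner point is nonnegative, so once the residual at x is zero
  every later minimum subtracted there is zero.\<close>

lemma residual_mono_zero:
  assumes "\<And>x. 0 \<le> f x" "residual f n x = 0" "n \<le> m"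
  shows "residual f m x = 0"
  using assms(3,2)
proof (induction rule: dec_induct)
  case (step k)
  then show ?case
    using residual_nonneg[of f k "flip k x"] assms(1) by simp
qed

lemma greedy_sums:
  assumes "f \<in> borel_measurable borel" "\<And>x. 0 \<le> f x"
  shows "AE x in unif01. (\<lambda>n. greedy f n x) sums f x"
proof -
  note [measurable] = assms(1)
  define A where "A = {x. \<forall>n. 0 < residual f n x}"
  have A: "A \<in> sets borel"
    unfolding A_def by measurable
  have "A \<inter> flip n -` A = {}" for n
  proof -
    \<comment> \<open>Positivity at x after step n says that the residual before that step was
      strictly larger at x than at \<open>flip n x\<close>; positivity at \<open>flip n x\<close>
      says the reverse.\<close>
    have False if "0 < residual f (Suc n) x" "0 < residual f (Suc n) (flip n x)" for x
      using that by (auto simp: min_def split: if_splits)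
    then show ?thesis
      unfolding A_def by blast
  qed
  then have "A \<in> null_sets unif01"
    using A by (auto intro!: null_setsI unif01_null_if_flip_disjoint)
  then have "AE x in unif01. x \<notin> A"
    by (rule AE_not_in)
  then show ?thesis
  proof eventually_elim
    case (elim x)
    then obtain n where "residual f n x = 0"
      using residual_nonneg[of f _ x, OF assms(2)] by (auto simp: A_def not_less intro: antisym)
    then have zero: "residual f m x = 0" if "n \<le> m" for m
      using that assms(2) residual_mono_zero by blast
    \<comment> \<open>From index n on the terms vanish, so the series is a finite sum, and
      \<open>sum_greedy\<close> telescopes it to \<open>f x\<close>.\<close>
    have "greedy f m x = 0" if "m \<notin> {..<n}" for m
      using that zero[of m] residual_nonneg[of f m "flip m x", OF assms(2)] by (simp add: greedy_def)
    then have "(\<lambda>n. greedy f n x) sums (\<Sum>k<n. greedy f k x)"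
      by (intro sums_finite) auto
    then show ?case
      by (simp add: sum_greedy zero)
  qed
qed

subsection \<open>Kernels and disintegrations\<close>

text \<open>Countability of the generator lets the exceptional null sets of the individual rays be
  merged into one in \<open>kernel_unique\<close>.\<close>

lemma borel_eq_rat_greaterThan: "(borel :: real measure) = sigma UNIV (range (\<lambda>q. {real_of_rat q<..}))"
proof (rule borel_eq_sigmaI1[OF borel_Ioi])
  fix X :: "real set"
  assume "X \<in> range greaterThan"
  then obtain a where "X = {a<..}" by auto
  also have "\<dots> = (\<Union>q\<in>{q. a < real_of_rat q}. {real_of_rat q<..})"
    by (auto dest: of_rat_dense intro: less_trans)
  also have "\<dots> \<in> sets (sigma UNIV (range (\<lambda>q. {real_of_rat q<..})))"
    by (rule sets.countable_UN') auto
  finally show "X \<in> sets (sigma UNIV (range (\<lambda>q. {real_of_rat q<..})))" .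
qed auto

lemma prob_kernel_measurable:
  "prob_kernel K \<Longrightarrow> K \<in> borel \<rightarrow>\<^sub>M subprob_algebra borel"
  by (simp add: prob_kernel_def measurable_prob_algebraD)

lemma prob_kernelD:
  assumes "prob_kernel K"
  shows "prob_space (K x)" "sets (K x) = sets borel" "space (K x) = UNIV"
proof -
  have "K x \<in> space (prob_algebra borel)"
    using assms measurable_space[of K borel "prob_algebra borel" x] by (simp add: prob_kernel_def)
  then show "prob_space (K x)" and s: "sets (K x) = sets borel"
    by (auto simp: space_prob_algebra)
  show "space (K x) = UNIV"
    using sets_eq_imp_space_eq[OF s] by simp
qed

lemma borel_measurable_prob_kernel:
  assumes "prob_kernel K" "B \<in> sets borel"
  shows "(\<lambda>x. emeasure (K x) B) \<in> borel_measurable borel"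
  using assms by (intro emeasure_measurable_subprob_algebra2[where N=borel] prob_kernel_measurable)
    (auto simp: space_pair_measure)

lemma kernel_unique:
  fixes M :: "real measure"
  assumes "finite_measure M" and M [measurable_cong]: "sets M = sets borel"
    and K: "prob_kernel K" "prob_kernel K'"
    and eq: "\<And>A B. A \<in> sets borel \<Longrightarrow> B \<in> sets borel \<Longrightarrow>
      (\<integral>\<^sup>+x. emeasure (K x) B * indicator A x \<partial>M) = (\<integral>\<^sup>+x. emeasure (K' x) B * indicator A x \<partial>M)"
  shows "AE x in M. K x = K' x"
proof -
  interpret finite_measure M by fact
  note [measurable] = borel_measurable_prob_kernel[OF K(1)] borel_measurable_prob_kernel[OF K(2)]
  \<comment> \<open>For a fixed ray, both kernels give densities with respect to \<open>M\<close>
    with equal integrals over every Borel set, hence equal almost everywhere.\<close>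
  have "AE x in M. emeasure (K x) {real_of_rat q<..} = emeasure (K' x) {real_of_rat q<..}" for q
    by (intro density_unique measure_eqI) (auto simp: emeasure_density M eq)
  then have "AE x in M. \<forall>q. emeasure (K x) {real_of_rat q<..} = emeasure (K' x) {real_of_rat q<..}"
    by (simp add: AE_all_countable)
  then show ?thesis
  proof eventually_elim
    case (elim x)
    interpret prob_space "K x" by (rule prob_kernelD[OF K(1)])
    let ?E = "range (\<lambda>q. {real_of_rat q<..})"
    have borel: "sets borel = sigma_sets UNIV ?E"
      by (subst borel_eq_rat_greaterThan) simp
    \<comment> \<open>The generating rays double as the countable cover of the line by sets of
      finite measure.\<close>
    show ?case
    proof (rule measure_eqI_generator_eq_countable[where E="?E" and \<Omega>=UNIV and A="?E"])
      show "Int_stable ?E"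
      proof (rule Int_stableI_image)
        fix p q :: rat
        have "max (real_of_rat p) (real_of_rat q) = real_of_rat (max p q)"
          by (simp add: max_def of_rat_less_eq)
        then have "{real_of_rat p<..} \<inter> {real_of_rat q<..} = {real_of_rat (max p q)<..}"
          by auto
        then show "\<exists>r\<in>UNIV. {real_of_rat p<..} \<inter> {real_of_rat q<..} = {real_of_rat r<..}"
          by blast
      qed
      show "sets (K x) = sigma_sets UNIV ?E" "sets (K' x) = sigma_sets UNIV ?E"
        using prob_kernelD[OF K(1)] prob_kernelD[OF K(2)] borel by simp_all
      have "t \<in> \<Union>?E" for t
        using of_rat_dense[of "t - 1" t] by auto
      then show "\<Union>?E = UNIV" by blast
    qed (use elim in auto)
  qed
qed

text \<open>The final statement concerns arbitrary disintegrations; uniqueness, tested on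
  rectangles, reduces it to the explicit kernels built for the joint law.\<close>

lemma disintegrates_X_unique:
  assumes \<pi>: "prob_space \<pi>" "sets \<pi> = sets borel"
    and K: "disintegrates_X \<pi> K" "disintegrates_X \<pi> K'"
  shows "AE x in marginal_X \<pi>. K x = K' x"
proof (rule kernel_unique)
  have fst: "fst \<in> \<pi> \<rightarrow>\<^sub>M borel"
    using \<pi>(2) by (simp add: borel_prod[symmetric] cong: measurable_cong_sets)
  then show "finite_measure (marginal_X \<pi>)"
    unfolding marginal_X_def by (intro prob_space.finite_measure prob_space.prob_space_distr \<pi>)
  fix A B :: "real set"
  assume "A \<in> sets borel" "B \<in> sets borel"
  then have AB: "A \<times> B \<in> sets borel"
    unfolding borel_prod[symmetric] by auto
  have rect: "emeasure \<pi> (A \<times> B) = (\<integral>\<^sup>+x. emeasure (L x) B * indicator A x \<partial>marginal_X \<pi>)"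
    if "disintegrates_X \<pi> L" for L
  proof -
    have "emeasure \<pi> (A \<times> B) = (\<integral>\<^sup>+x. emeasure (L x) {y. (x, y) \<in> A \<times> B} \<partial>marginal_X \<pi>)"
      using that AB unfolding disintegrates_X_def by blast
    also have "\<dots> = (\<integral>\<^sup>+x. emeasure (L x) B * indicator A x \<partial>marginal_X \<pi>)"
      by (intro nn_integral_cong) (simp add: indicator_def)
    finally show ?thesis .
  qed
  show "(\<integral>\<^sup>+x. emeasure (K x) B * indicator A x \<partial>marginal_X \<pi>) =
      (\<integral>\<^sup>+x. emeasure (K' x) B * indicator A x \<partial>marginal_X \<pi>)"
    unfolding rect[OF K(1), symmetric] by (rule rect[OF K(2)])
qed (use K in \<open>auto simp: disintegrates_X_def marginal_X_def\<close>)

lemma disintegrates_Y_unique: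
  assumes \<pi>: "prob_space \<pi>" "sets \<pi> = sets borel"
    and K: "disintegrates_Y \<pi> K" "disintegrates_Y \<pi> K'"
  shows "AE y in marginal_Y \<pi>. K y = K' y"
proof (rule kernel_unique)
  have snd: "snd \<in> \<pi> \<rightarrow>\<^sub>M borel"
    using \<pi>(2) by (simp add: borel_prod[symmetric] cong: measurable_cong_sets)
  then show "finite_measure (marginal_Y \<pi>)"
    unfolding marginal_Y_def by (intro prob_space.finite_measure prob_space.prob_space_distr \<pi>)
  fix A B :: "real set"
  assume "A \<in> sets borel" "B \<in> sets borel"
  then have AB: "B \<times> A \<in> sets borel"
    unfolding borel_prod[symmetric] by auto
  have rect: "emeasure \<pi> (B \<times> A) = (\<integral>\<^sup>+y. emeasure (L y) B * indicator A y \<partial>marginal_Y \<pi>)"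
    if "disintegrates_Y \<pi> L" for L
  proof -
    have "emeasure \<pi> (B \<times> A) = (\<integral>\<^sup>+y. emeasure (L y) {x. (x, y) \<in> B \<times> A} \<partial>marginal_Y \<pi>)"
      using that AB unfolding disintegrates_Y_def by blast
    also have "\<dots> = (\<integral>\<^sup>+y. emeasure (L y) B * indicator A y \<partial>marginal_Y \<pi>)"
      by (intro nn_integral_cong) (simp add: indicator_def)
    finally show ?thesis .
  qed
  show "(\<integral>\<^sup>+y. emeasure (K y) B * indicator A y \<partial>marginal_Y \<pi>) =
      (\<integral>\<^sup>+y. emeasure (K' y) B * indicator A y \<partial>marginal_Y \<pi>)"
    unfolding rect[OF K(1), symmetric] by (rule rect[OF K(2)])
qed (use K in \<open>auto simp: disintegrates_Y_def marginal_Y_def\<close>)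

section \<open>Measurability of the Dirac set\<close>

lemma borel_measurable_atom:
  assumes K: "prob_kernel K"
  shows "(\<lambda>(y, u). emeasure (K y) {u}) \<in> borel_measurable (borel \<Otimes>\<^sub>M borel)"
  unfolding case_prod_unfold
proof (rule emeasure_measurable_subprob_algebra2[where N=borel])
  \<comment> \<open>The singleton \<open>{u}\<close> is the section over (y, u) of the set where
    second and third coordinates agree, which is measurable.\<close>
  have "{p \<in> space ((borel \<Otimes>\<^sub>M borel) \<Otimes>\<^sub>M borel). snd (fst p) = (snd p :: real)}
      \<in> sets ((borel \<Otimes>\<^sub>M borel :: (real \<times> real) measure) \<Otimes>\<^sub>M borel)"
    by measurable
  moreover have "(SIGMA p:space (borel \<Otimes>\<^sub>M borel :: (real \<times> real) measure). {snd p}) =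
      {p \<in> space ((borel \<Otimes>\<^sub>M borel) \<Otimes>\<^sub>M borel). snd (fst p) = (snd p :: real)}"
    by (auto simp: space_pair_measure)
  ultimately show "(SIGMA p:space (borel \<Otimes>\<^sub>M borel :: (real \<times> real) measure). {snd p}) \<in> sets ((borel \<Otimes>\<^sub>M borel) \<Otimes>\<^sub>M borel)"
    by simp
  show "(\<lambda>p. K (fst p)) \<in> borel \<Otimes>\<^sub>M borel \<rightarrow>\<^sub>M subprob_algebra borel"
    by (rule measurable_compose[OF measurable_fst prob_kernel_measurable[OF K]])
qed

text \<open>The integral is the probability that two independent draws from \<open>M\<close>
  coincide. This removes the uncountable quantifier over the position of the mass, so that the Dirac
  set becomes visibly Borel.\<close>

lemma return_iff_nn_integral_singleton:
  fixes M :: "real measure"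
  assumes "prob_space M" and M: "sets M = sets borel"
  shows "(\<exists>x. M = return borel x) \<longleftrightarrow> (\<integral>\<^sup>+u. emeasure M {u} \<partial>M) = 1"
proof
  assume "\<exists>x. M = return borel x"
  then obtain x where x: "M = return borel x" by auto
  have "(\<integral>\<^sup>+u. emeasure M {u} \<partial>M) = (\<integral>\<^sup>+u. indicator {x} u \<partial>return borel x)"
    unfolding x by (intro nn_integral_cong) (auto simp: indicator_def)
  then show "(\<integral>\<^sup>+u. emeasure M {u} \<partial>M) = 1"
    by simp
next
  interpret prob_space M by fact
  assume int: "(\<integral>\<^sup>+u. emeasure M {u} \<partial>M) = 1"
  \<comment> \<open>Viewing \<open>M\<close> as a constant kernel yields measurability of its atom
    function.\<close>
  have "prob_kernel (\<lambda>_. M)"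
    unfolding prob_kernel_def using assms by (intro measurable_const) (simp add: space_prob_algebra)
  from measurable_Pair2[OF borel_measurable_atom[OF this], of 0]
  have [measurable]: "(\<lambda>u. emeasure M {u}) \<in> borel_measurable M"
    using M by (simp cong: measurable_cong_sets)
  have "(\<integral>\<^sup>+u. 1 - emeasure M {u} \<partial>M) = (\<integral>\<^sup>+u. 1 \<partial>M) - (\<integral>\<^sup>+u. emeasure M {u} \<partial>M)"
    using int by (intro nn_integral_diff) (auto simp: emeasure_le_1)
  then have "AE u in M. 1 - emeasure M {u} = 0"
    by (subst nn_integral_0_iff_AE[symmetric]) (simp_all add: int emeasure_space_1)
  then have "AE u in M. emeasure M {u} = 1"
    using emeasure_le_1 by (auto simp: diff_eq_0_iff_ennreal elim!: eventually_mono intro: antisym)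
  then obtain x where x: "emeasure M {x} = 1"
    by (metis (mono_tags, lifting) AE_False eventually_mono)
  have "AE u in M. u = x"
    using x M by (subst AE_iff_emeasure_eq_1) (auto simp: sets_eq_imp_space_eq[OF M])
  then have "emeasure M A = indicator A x" if "A \<in> sets borel" for A
    using that M emeasure_space_1
    by (subst emeasure_eq_AE[where B="if x \<in> A then UNIV else {}"])
       (auto simp: sets_eq_imp_space_eq[OF M] elim: eventually_mono)
  then have "M = return borel x"
    using M by (intro measure_eqI) auto
  then show "\<exists>x. M = return borel x" ..
qed

lemma dirac_set_sets:
  assumes K: "prob_kernel K"
  shows "dirac_set K \<in> sets borel"
proof -
  note [measurable] = prob_kernel_measurable[OF K]
  have "(\<lambda>(y, u). emeasure (K y) {u}) \<in> borel_measurable (borel \<Otimes>\<^sub>M borel)"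
    by (rule borel_measurable_atom[OF K])
  then have "(\<lambda>y. \<integral>\<^sup>+u. emeasure (K y) {u} \<partial>K y) \<in> borel_measurable borel"
    by (intro nn_integral_measurable_subprob_algebra2[where N=borel]) auto
  moreover have "dirac_set K = {y. (\<integral>\<^sup>+u. emeasure (K y) {u} \<partial>K y) = 1}"
    unfolding dirac_set_def using return_iff_nn_integral_singleton prob_kernelD[OF K] by metis
  ultimately show ?thesis
    by simp
qed

subsection \<open>The joint law\<close>

abbreviation geo :: "nat pmf" where
  "geo \<equiv> geometric_pmf (1 / 2)"

definition joint :: "(real \<times> real) measure" where
  "joint = distr (unif01 \<Otimes>\<^sub>M geo) borel (\<lambda>(x, n). (x, real n + flip_rep n x))"

definition kernel_X :: "real \<Rightarrow> real measure" where
  "kernel_X x = distr geo borel (\<lambda>n. real n + flip_rep n x)"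

text \<open>A fair coin chooses between the two points of the orbit decoded from y. The formula also
  covers y outside the range of Y, where \<open>nat\<close> sends negative floors to 0, so its law
  is never Dirac.\<close>

definition kernel_Y :: "real \<Rightarrow> real measure" where
  "kernel_Y y = distr (bernoulli_pmf (1 / 2)) borel
     (\<lambda>b. if b then frac y else flip (nat \<lfloor>y\<rfloor>) (frac y))"

lemma measurable_frac [measurable]: "(frac :: real \<Rightarrow> real) \<in> borel_measurable borel"
  unfolding frac_def[abs_def] by measurable

lemma measurable_encode [measurable]:
  "(\<lambda>(x, n). (x, real n + flip_rep n x)) \<in> unif01 \<Otimes>\<^sub>M geo \<rightarrow>\<^sub>M borel"
  unfolding borel_prod[symmetric] by measurable

interpretation unif01_geo: pair_prob_space unif01 geo
  by (intro pair_prob_space.intro pair_sigma_finite.intro prob_space_unif01 measure_pmf.prob_space_axioms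
        prob_space_imp_sigma_finite)

lemma prob_space_joint: "prob_space joint"
  unfolding joint_def by (intro unif01_geo.prob_space_distr) measurable

lemma sets_joint: "sets joint = sets borel"
  by (simp add: joint_def)

text \<open>The first order of integration suits conditioning on X; the second fixes the index, so
  that invariance under one flip can be used.\<close>

lemma nn_integral_joint:
  assumes [measurable]: "f \<in> borel_measurable borel"
  shows "(\<integral>\<^sup>+z. f z \<partial>joint) = (\<integral>\<^sup>+x. \<integral>\<^sup>+n. f (x, real n + flip_rep n x) \<partial>geo \<partial>unif01)"
    and "(\<integral>\<^sup>+z. f z \<partial>joint) = (\<integral>\<^sup>+n. \<integral>\<^sup>+x. f (x, real n + flip_rep n x) \<partial>unif01 \<partial>geo)"
proof -
  have m: "(\<lambda>p. f (case p of (x, n) \<Rightarrow> (x, real n + flip_rep n x))) \<in> borel_measurable (unif01 \<Otimes>\<^sub>M geo)"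
    by measurable
  have "(\<integral>\<^sup>+z. f z \<partial>joint) = (\<integral>\<^sup>+p. f (case p of (x, n) \<Rightarrow> (x, real n + flip_rep n x)) \<partial>(unif01 \<Otimes>\<^sub>M geo))"
    unfolding joint_def by (rule nn_integral_distr) measurable
  then show *: "(\<integral>\<^sup>+z. f z \<partial>joint) = (\<integral>\<^sup>+x. \<integral>\<^sup>+n. f (x, real n + flip_rep n x) \<partial>geo \<partial>unif01)"
    using measure_pmf.nn_integral_fst[OF m] by simp
  show "(\<integral>\<^sup>+z. f z \<partial>joint) = (\<integral>\<^sup>+n. \<integral>\<^sup>+x. f (x, real n + flip_rep n x) \<partial>unif01 \<partial>geo)"
    unfolding * using unif01_geo.Fubini[OF m] by simp
qed

lemma marginal_X_joint: "marginal_X joint = unif01"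
proof -
  have "marginal_X joint = distr (unif01 \<Otimes>\<^sub>M geo) unif01 fst"
    unfolding marginal_X_def joint_def
    by (subst distr_distr) (auto simp: comp_def case_prod_unfold borel_prod[symmetric] intro!: distr_cong)
  then show ?thesis
    by (simp add: measure_pmf.distr_pair_fst)
qed

lemma nn_integral_marginal_Y_joint:
  assumes [measurable]: "f \<in> borel_measurable borel"
  shows "(\<integral>\<^sup>+y. f y \<partial>marginal_Y joint) = (\<integral>\<^sup>+n. \<integral>\<^sup>+x. f (real n + flip_rep n x) \<partial>unif01 \<partial>geo)"
proof -
  have snd: "snd \<in> (borel :: (real \<times> real) measure) \<rightarrow>\<^sub>M borel"
    by (simp add: borel_prod[symmetric])
  have "(\<integral>\<^sup>+y. f y \<partial>marginal_Y joint) = (\<integral>\<^sup>+z. f (snd z) \<partial>joint)"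
    unfolding marginal_Y_def using snd
    by (intro nn_integral_distr) (simp_all add: sets_joint cong: measurable_cong_sets)
  also have "\<dots> = (\<integral>\<^sup>+n. \<integral>\<^sup>+x. f (real n + flip_rep n x) \<partial>unif01 \<partial>geo)"
    using measurable_compose[OF snd assms] by (subst nn_integral_joint(2)) simp_all
  finally show ?thesis .
qed

section \<open>The two disintegrations of the joint law\<close>

lemma prob_kernel_X: "prob_kernel kernel_X"
  unfolding prob_kernel_def kernel_X_def
  by (rule measurable_distr_prob_space2[where M="count_space UNIV"])
     (auto intro!: measurable_const simp: space_prob_algebra measure_pmf.prob_space_axioms)

lemma prob_kernel_Y: "prob_kernel kernel_Y"
  unfolding prob_kernel_def kernel_Y_def
proof (rule measurable_distr_prob_space2[where M="count_space UNIV"])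
  show "(\<lambda>(y, b). if b then frac y else flip (nat \<lfloor>y\<rfloor>) (frac y)) \<in> borel \<Otimes>\<^sub>M count_space UNIV \<rightarrow>\<^sub>M borel"
    unfolding case_prod_unfold by measurable
qed (auto intro!: measurable_const simp: space_prob_algebra measure_pmf.prob_space_axioms)

lemma sets_section:
  assumes "E \<in> sets (borel :: (real \<times> real) measure)"
  shows "{y. (x, y) \<in> E} \<in> sets borel" "{x. (x, y) \<in> E} \<in> sets borel"
proof -
  have "E \<in> sets (borel \<Otimes>\<^sub>M borel)"
    using assms unfolding borel_prod .
  from sets_Pair1[OF this, of x] sets_Pair2[OF this, of y]
  show "{y. (x, y) \<in> E} \<in> sets borel" "{x. (x, y) \<in> E} \<in> sets borel"
    by (auto simp: vimage_def)
qed

lemma disintegrates_X_joint: "disintegrates_X joint kernel_X"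
  unfolding disintegrates_X_def marginal_X_joint
proof (intro conjI ballI prob_kernel_X)
  fix E :: "(real \<times> real) set"
  assume E: "E \<in> sets borel"
  have "emeasure joint E = (\<integral>\<^sup>+z. indicator E z \<partial>joint)"
    using E by (simp add: sets_joint)
  also have "\<dots> = (\<integral>\<^sup>+x. \<integral>\<^sup>+n. indicator E (x, real n + flip_rep n x) \<partial>geo \<partial>unif01)"
    using E by (intro nn_integral_joint(1)) simp
  also have "\<dots> = (\<integral>\<^sup>+x. emeasure (kernel_X x) {y. (x, y) \<in> E} \<partial>unif01)"
  proof (rule nn_integral_cong)
    fix x
    have "emeasure (kernel_X x) {y. (x, y) \<in> E} = (\<integral>\<^sup>+y. indicator {y. (x, y) \<in> E} y \<partial>kernel_X x)"
      using sets_section(1)[OF E, of x] by (simp add: kernel_X_def)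
    also have "\<dots> = (\<integral>\<^sup>+n. indicator E (x, real n + flip_rep n x) \<partial>geo)"
      unfolding kernel_X_def using sets_section(1)[OF E, of x]
      by (subst nn_integral_distr) (auto simp: indicator_def)
    finally show "(\<integral>\<^sup>+n. indicator E (x, real n + flip_rep n x) \<partial>geo) = emeasure (kernel_X x) {y. (x, y) \<in> E}" ..
  qed
  finally show "emeasure joint E = (\<integral>\<^sup>+x. emeasure (kernel_X x) {y. (x, y) \<in> E} \<partial>unif01)" .
qed

lemma emeasure_kernel_Y:
  assumes "A \<in> sets borel"
  shows "emeasure (kernel_Y y) A = (indicator A (frac y) + indicator A (flip (nat \<lfloor>y\<rfloor>) (frac y))) / 2"
proof -
  have "emeasure (kernel_Y y) A = (\<integral>\<^sup>+u. indicator A u \<partial>kernel_Y y)"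
    using assms by (simp add: kernel_Y_def)
  also have "\<dots> = (\<integral>\<^sup>+b. indicator A (if b then frac y else flip (nat \<lfloor>y\<rfloor>) (frac y)) \<partial>bernoulli_pmf (1 / 2))"
    unfolding kernel_Y_def using assms by (subst nn_integral_distr) auto
  also have "\<dots> = (indicator A (frac y) + indicator A (flip (nat \<lfloor>y\<rfloor>) (frac y))) / 2"
    by (simp add: divide_ennreal_def distrib_right ennreal_half)
  finally show ?thesis .
qed

text \<open>For a fixed index the kernel averages the integrand over the orbit of x. Flip invariance
  of the uniform law shows that averaging leaves the integral unchanged.\<close>

lemma disintegrates_Y_joint: "disintegrates_Y joint kernel_Y"
  unfolding disintegrates_Y_def
proof (intro conjI ballI prob_kernel_Y)
  fix E :: "(real \<times> real) set"
  assume E: "E \<in> sets borel"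
  have E' [measurable]: "E \<in> sets (borel \<Otimes>\<^sub>M borel)"
    using E unfolding borel_prod .
  have meas: "(\<lambda>y. emeasure (kernel_Y y) {x. (x, y) \<in> E}) \<in> borel_measurable borel"
  proof -
    have "indicator {x. (x, y) \<in> E} u = (indicator E (u, y) :: ennreal)" for u y
      by (simp add: indicator_def)
    then show ?thesis
      unfolding emeasure_kernel_Y[OF sets_section(2)[OF E]] by simp
  qed
  have "emeasure joint E = (\<integral>\<^sup>+z. indicator E z \<partial>joint)"
    using E by (simp add: sets_joint)
  also have "\<dots> = (\<integral>\<^sup>+n. \<integral>\<^sup>+x. indicator E (x, real n + flip_rep n x) \<partial>unif01 \<partial>geo)"
    using E by (intro nn_integral_joint(2)) simp
  also have "\<dots> = (\<integral>\<^sup>+n. \<integral>\<^sup>+x. emeasure (kernel_Y (real n + flip_rep n x)) {u. (u, real n + flip_rep n x) \<in> E} \<partial>unif01 \<partial>geo)"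
  proof (rule nn_integral_cong)
    fix n
    define G :: "real \<Rightarrow> ennreal" where "G x = indicator E (x, real n + flip_rep n x)" for x
    have [measurable]: "G \<in> borel_measurable borel"
      unfolding G_def by measurable
    have "(\<integral>\<^sup>+x. emeasure (kernel_Y (real n + flip_rep n x)) {u. (u, real n + flip_rep n x) \<in> E} \<partial>unif01) =
        (\<integral>\<^sup>+x. (G x + G (flip n x)) / 2 \<partial>unif01)"
    proof (rule nn_integral_cong_AE, use AE_unif01_unit in eventually_elim)
      case (elim x)
      have "emeasure (kernel_Y (real n + flip_rep n x)) {u. (u, real n + flip_rep n x) \<in> E} =
          (indicator E (flip_rep n x, real n + flip_rep n x) + indicator E (flip n (flip_rep n x), real n + flip_rep n x)) / 2"
        unfolding emeasure_kernel_Y[OF sets_section(2)[OF E]] decode_flip_rep[OF elim]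
        by (simp add: indicator_def)
      \<comment> \<open>Both orbit points share one label, hence one second coordinate. The label is
        x or \<open>flip n x\<close>, so the sum runs over the orbit in one of its two
        orders.\<close>
      also have "\<dots> = (G (flip_rep n x) + G (flip n (flip_rep n x))) / 2"
        using flip_rep_cases[of n x] by (metis G_def flip_rep_flip)
      also have "\<dots> = (G x + G (flip n x)) / 2"
        using flip_rep_cases[of n x] by (metis add.commute flip_flip)
      finally show ?case .
    qed
    also have "\<dots> = ((\<integral>\<^sup>+x. G x \<partial>unif01) + (\<integral>\<^sup>+x. G (flip n x) \<partial>unif01)) / 2"
      by (simp add: nn_integral_divide nn_integral_add)
    also have "\<dots> = (\<integral>\<^sup>+x. G x \<partial>unif01)"
      by (simp add: nn_integral_unif01_flip mult_2[symmetric] mult.commute[of 2] mult_divide_eq_ennreal)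
    finally show "(\<integral>\<^sup>+x. indicator E (x, real n + flip_rep n x) \<partial>unif01) =
        (\<integral>\<^sup>+x. emeasure (kernel_Y (real n + flip_rep n x)) {u. (u, real n + flip_rep n x) \<in> E} \<partial>unif01)"
      by (simp add: G_def)
  qed
  also have "\<dots> = (\<integral>\<^sup>+y. emeasure (kernel_Y y) {x. (x, y) \<in> E} \<partial>marginal_Y joint)"
    by (rule nn_integral_marginal_Y_joint[OF meas, symmetric])
  finally show "emeasure joint E = (\<integral>\<^sup>+y. emeasure (kernel_Y y) {x. (x, y) \<in> E} \<partial>marginal_Y joint)" .
qed

text \<open>The two orbit points differ, so no singleton receives mass above 1/2.\<close>

lemma kernel_Y_not_return: "kernel_Y y \<noteq> return borel x"
proof
  assume eq: "kernel_Y y = return borel x"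
  have "(indicator {x} (frac y) + indicator {x} (flip (nat \<lfloor>y\<rfloor>) (frac y)) :: ennreal) / 2 = 1"
    using emeasure_kernel_Y[of "{x}" y] by (simp add: eq)
  moreover have "\<not> (frac y = x \<and> flip (nat \<lfloor>y\<rfloor>) (frac y) = x)"
    using flip_neq by metis
  moreover have "inverse (2 :: ennreal) \<noteq> 1"
  proof -
    have "ennreal (1 / 2) \<noteq> 1"
      by (simp only: ennreal_eq_1)
    then show ?thesis by simp
  qed
  ultimately show False
    by (cases "frac y = x"; cases "flip (nat \<lfloor>y\<rfloor>) (frac y) = x")
       (simp_all add: divide_ennreal_def)
qed

section \<open>Absolute continuity of the marginals\<close>

lemma absolutely_continuous_marginal_X: "absolutely_continuous lborel (marginal_X joint)"
  unfolding marginal_X_joint unif01_def by (intro absolutely_continuousI_density) simp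

text \<open>For a fixed index, Y is n + x or n + \<open>flip n x\<close>. The indicator is bounded
  by the sum over both options, and flip invariance reduces the second to a translation.\<close>

lemma absolutely_continuous_marginal_Y: "absolutely_continuous lborel (marginal_Y joint)"
  unfolding absolutely_continuous_def
proof
  fix A :: "real set"
  assume A: "A \<in> null_sets lborel"
  then have [measurable]: "A \<in> sets borel" by auto
  have "(\<integral>\<^sup>+x. indicator A (real n + flip_rep n x) \<partial>unif01) = 0" for n
  proof -
    have shift: "(\<integral>\<^sup>+x. indicator A (real n + x) \<partial>unif01) = 0"
    proof -
      have "(\<integral>\<^sup>+x. indicator A (real n + x) \<partial>unif01) \<le> (\<integral>\<^sup>+x. indicator A (real n + x) \<partial>lborel)"
        unfolding unif01_def by (subst nn_integral_density) (auto intro!: nn_integral_mono simp: indicator_def)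
      also have "\<dots> = (\<integral>\<^sup>+x. indicator A x \<partial>lborel)"
        by (subst (2) nn_integral_real_affine[where c=1 and t="real n"]) auto
      also have "\<dots> = 0"
        using A by auto
      finally show ?thesis by simp
    qed
    have "(\<integral>\<^sup>+x. indicator A (real n + flip_rep n x) \<partial>unif01) \<le>
        (\<integral>\<^sup>+x. indicator A (real n + x) + indicator A (real n + flip n x) \<partial>unif01)"
    proof (rule nn_integral_mono)
      fix x
      show "indicator A (real n + flip_rep n x) \<le> (indicator A (real n + x) + indicator A (real n + flip n x) :: ennreal)"
        using flip_rep_cases[of n x] by auto
    qed
    also have "\<dots> = (\<integral>\<^sup>+x. indicator A (real n + x) \<partial>unif01) + (\<integral>\<^sup>+x. indicator A (real n + flip n x) \<partial>unif01)"
      by (intro nn_integral_add) auto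
    also have "\<dots> = 0"
      using nn_integral_unif01_flip[of "\<lambda>x. indicator A (real n + x)" n] shift by simp
    finally show ?thesis by simp
  qed
  then have "emeasure (marginal_Y joint) A = 0"
    using nn_integral_marginal_Y_joint[of "indicator A"] by (simp add: marginal_Y_def)
  then show "A \<in> null_sets (marginal_Y joint)"
    by (auto simp: null_sets_def marginal_Y_def)
qed

section \<open>Property (R_+), nullity of the Dirac set and failure of condition (D)\<close>

lemma nn_integral_kernel_X:
  assumes [measurable]: "g \<in> borel_measurable borel"
  shows "(\<integral>\<^sup>+y. g y \<partial>kernel_X x) = (\<Sum>n. ennreal ((1 / 2) ^ Suc n) * g (real n + flip_rep n x))"
  unfolding kernel_X_def
  by (subst nn_integral_distr) (auto simp: nn_integral_measure_pmf nn_integral_count_space_nat)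

lemma property_R_plus_joint:
  assumes KX: "disintegrates_X joint KX"
  shows "property_R_plus joint KX"
  unfolding property_R_plus_def
proof (intro allI impI)
  fix f :: "real \<Rightarrow> real"
  assume f: "integrable (marginal_X joint) f \<and> (AE x in marginal_X joint. 0 \<le> f x)"
  \<comment> \<open>Nonnegativity of \<open>f\<close> holds only almost everywhere, whereas the
    greedy procedure requires it everywhere.\<close>
  define F where "F x = max 0 (f x)" for x
  have f_meas [measurable]: "f \<in> borel_measurable borel"
    using f by (auto simp: marginal_X_joint dest: borel_measurable_integrable cong: measurable_cong_sets)
  have F [measurable]: "F \<in> borel_measurable borel" and F0: "\<And>x. 0 \<le> F x"
    unfolding F_def by auto
  \<comment> \<open>The index and the label are read off y; the power of 2 cancels the geometric
    weight. Evaluating at the label is harmless because the greedy term is constant on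
    orbits.\<close>
  define g where "g y = 2 ^ Suc (nat \<lfloor>y\<rfloor>) * greedy F (nat \<lfloor>y\<rfloor>) (frac y)" for y
  \<comment> \<open>In \<open>g\<close> the index varies with y, so joint measurability is required;
    it follows from countability of the index set.\<close>
  have [measurable]: "(\<lambda>(n, x). greedy F n x) \<in> borel_measurable (count_space UNIV \<Otimes>\<^sub>M borel)"
    by (rule measurable_pair_measure_countable1) auto
  have g [measurable]: "g \<in> borel_measurable borel"
    unfolding g_def by measurable
  have g0: "0 \<le> g y" for y
    by (simp add: g_def greedy_nonneg F0)
  have "AE x in unif01. ennreal (f x) = (\<integral>\<^sup>+y. ennreal (g y) \<partial>KX x)"
    using greedy_sums[OF F F0] AE_unif01_unit
      disintegrates_X_unique[OF prob_space_joint sets_joint KX disintegrates_X_joint, unfolded marginal_X_joint]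
      conjunct2[OF f, unfolded marginal_X_joint]
  proof eventually_elim
    case (elim x)
    have "ennreal ((1 / 2) ^ Suc n) * ennreal (g (real n + flip_rep n x)) = ennreal (greedy F n x)" for n
      using decode_flip_rep[OF elim(2), of n]
      by (simp add: g_def greedy_flip_rep power_one_over flip: ennreal_mult')
    then have "(\<integral>\<^sup>+y. ennreal (g y) \<partial>KX x) = (\<Sum>n. ennreal (greedy F n x))"
      unfolding elim(3) by (subst nn_integral_kernel_X) auto
    also have "\<dots> = ennreal (F x)"
      using elim(1) greedy_nonneg[of F, OF F0] by (subst suminf_ennreal_eq[OF _ elim(1)]) auto
    finally show ?case
      using elim(4) by (simp add: F_def)
  qed
  then show "\<exists>g. g \<in> borel_measurable borel \<and> (\<forall>y. 0 \<le> g y) \<and>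
      (AE x in marginal_X joint. ennreal (f x) = (\<integral>\<^sup>+y. ennreal (g y) \<partial>KX x))"
    unfolding marginal_X_joint using g g0 by blast
qed

lemma dirac_set_null:
  assumes KY: "disintegrates_Y joint KY"
  shows "dirac_set KY \<in> null_sets (marginal_Y joint)"
proof -
  have D: "dirac_set KY \<in> sets (marginal_Y joint)"
    using KY dirac_set_sets by (simp add: disintegrates_Y_def marginal_Y_def)
  moreover have "AE y in marginal_Y joint. y \<notin> dirac_set KY"
    using disintegrates_Y_unique[OF prob_space_joint sets_joint KY disintegrates_Y_joint]
    by eventually_elim (simp add: dirac_set_def kernel_Y_not_return)
  ultimately show ?thesis
    by (simp add: AE_iff_null_sets)
qed

text \<open>Disintegrating the product of the line with D along X shows that the mean of the
  conditional masses of D is its second-marginal mass, which is zero. These masses thus vanish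
  almost everywhere, and a probability measure cannot also make them positive almost
  everywhere.\<close>

lemma not_condition_D_if_null:
  assumes \<pi>: "prob_space \<pi>" "sets \<pi> = sets borel"
    and KX: "disintegrates_X \<pi> KX" and D: "dirac_set KY \<in> null_sets (marginal_Y \<pi>)"
  shows "\<not> condition_D \<pi> KX KY"
proof
  assume pos: "condition_D \<pi> KX KY"
  have fst: "fst \<in> \<pi> \<rightarrow>\<^sub>M borel" and snd: "snd \<in> \<pi> \<rightarrow>\<^sub>M borel"
    using \<pi>(2) by (simp_all add: borel_prod[symmetric] cong: measurable_cong_sets)
  interpret X: prob_space "marginal_X \<pi>"
    unfolding marginal_X_def by (rule prob_space.prob_space_distr[OF \<pi>(1) fst])
  have D_sets: "dirac_set KY \<in> sets borel"
    using D by (auto simp: marginal_Y_def)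
  then have "(UNIV :: real set) \<times> dirac_set KY \<in> sets borel"
    unfolding borel_prod[symmetric] by (intro pair_measureI) auto
  then have "emeasure \<pi> (UNIV \<times> dirac_set KY) =
      (\<integral>\<^sup>+x. emeasure (KX x) {y. (x, y) \<in> (UNIV :: real set) \<times> dirac_set KY} \<partial>marginal_X \<pi>)"
    using KX unfolding disintegrates_X_def by blast
  moreover have "(UNIV :: real set) \<times> dirac_set KY = snd -` dirac_set KY \<inter> space \<pi>"
    using sets_eq_imp_space_eq[OF \<pi>(2)] by auto
  then have "emeasure \<pi> (UNIV \<times> dirac_set KY) = 0"
    using D D_sets snd by (simp add: marginal_Y_def null_sets_def emeasure_distr)
  ultimately have "(\<integral>\<^sup>+x. emeasure (KX x) (dirac_set KY) \<partial>marginal_X \<pi>) = 0"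
    by simp
  moreover have "(\<lambda>x. emeasure (KX x) (dirac_set KY)) \<in> borel_measurable (marginal_X \<pi>)"
    using borel_measurable_prob_kernel[of KX, OF _ D_sets] KX
    by (simp add: disintegrates_X_def marginal_X_def)
  ultimately have "AE x in marginal_X \<pi>. emeasure (KX x) (dirac_set KY) = 0"
    by (simp add: nn_integral_0_iff_AE)
  with pos have "AE x in marginal_X \<pi>. False"
    unfolding condition_D_def by eventually_elim simp
  then show False
    by simp
qed

theorem theorem2p13:
  "\<exists>\<pi> :: (real \<times> real) measure.
     prob_space \<pi> \<and> sets \<pi> = sets borel \<and>
     absolutely_continuous lborel (marginal_X \<pi>) \<and>
     absolutely_continuous lborel (marginal_Y \<pi>) \<and>
     (\<exists>KX KY. disintegrates_X \<pi> KX \<and> disintegrates_Y \<pi> KY) \<and>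
     (\<forall>KX KY. disintegrates_X \<pi> KX \<and> disintegrates_Y \<pi> KY \<longrightarrow>
        dirac_set KY \<in> null_sets (marginal_Y \<pi>) \<and>
        \<not> condition_D \<pi> KX KY \<and>
        property_R_plus \<pi> KX)"
proof (intro exI[of _ joint] conjI allI impI)
  show "\<exists>KX KY. disintegrates_X joint KX \<and> disintegrates_Y joint KY"
    using disintegrates_X_joint disintegrates_Y_joint by blast
next
  fix KX KY
  assume "disintegrates_X joint KX \<and> disintegrates_Y joint KY"
  then have KX: "disintegrates_X joint KX" and KY: "disintegrates_Y joint KY"
    by auto
  show "dirac_set KY \<in> null_sets (marginal_Y joint)"
    by (rule dirac_set_null[OF KY])
  then show "\<not> condition_D joint KX KY"
    by (rule not_condition_D_if_null[OF prob_space_joint sets_joint KX])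
  show "property_R_plus joint KX"
    by (rule property_R_plus_joint[OF KX])
qed (rule prob_space_joint sets_joint absolutely_continuous_marginal_X absolutely_continuous_marginal_Y)+

end
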